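(* Assume that the following statement (Conjecture C) is true: for every integer $k\ge2$, every permutation $(p_1,\dots,p_{k-1})$ of the set $\{\frac12,\frac1{2^2},\dots,\frac1{2^{k-1}}\}$, every $n\geq k+2$, and every optimal set of $n$-means $\{a_1,\dots,a_n\}$ with $a_1<\cdots<a_n$ for the measure $\sum_{j=1}^{k-1}p_j\delta_j+\sum_{j=k}^\infty\frac1{2^j}\delta_j$, one has $a_1=1,\ a_2=2,\ \dots,\ a_{n-3}=n-3$. Let $P=\frac1{2^2}\delta_1+\frac12\delta_2+\sum_{j=3}^\infty\frac1{2^j}\delta_j$. Then for all $n\geq5$ the sets $$\{1,2,\dots,n-3,\,Av[n-2,n-1],\,Av[n,n+1],\,Av[n+2,\infty)\}$$ and $$\{1,2,\dots,n-3,\,n-2,\,Av[n-1,n],\,Av[n+1,\infty)\}$$ form the optimal sets of $n$-means for $P$, with quantization error $V_n(P)=\frac{2^{3-n}}{3}$.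
   Context: $\delta_x$ denotes the Dirac measure at $x\in\mathbb R$. For a Borel probability measure $P$ on $\mathbb R$ and a nonempty finite set $\alpha\subset\mathbb R$, the distortion error is $V(P;\alpha)=\int\min_{a\in\alpha}|x-a|^2\,dP(x)$. The $n$th quantization error is $V_n(P)=\inf\{V(P;\alpha):\alpha\subset\mathbb R,\ 1\le\mathrm{card}(\alpha)\le n\}$. An optimal set of $n$-means for $P$ is a set $\alpha$ with at most $n$ points for which this infimum is attained. With $p_m=P(\{m\})$ and $i\le\ell$ positive integers, $Av[i,\ell]=\frac{\sum_{m=i}^{\ell}p_m m}{\sum_{m=i}^{\ell}p_m}$ and $Av[i,\infty)=\frac{\sum_{m=i}^{\infty}p_m m}{\sum_{m=i}^{\infty}p_m}$. *)

theory Defs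
  imports "HOL-Probability.Probability"
begin

text \<open>
  The measure \<open>\<Sum>j\<ge>1. w j \<cdot> \<delta>\<^sub>j\<close> on the Borel sets of the real line.  The Dirac measure at \<open>x\<close> is
  \<^term>\<open>return borel x\<close>; the index is shifted by \<^const>\<open>Suc\<close> because the series starts at 1.
  The lemma \<open>emeasure_dirac_series\<close> shows that \<^const>\<open>measure_of\<close> does yield this set function.
\<close>

definition dirac_series :: "(nat \<Rightarrow> real) \<Rightarrow> real measure" where
  "dirac_series w = measure_of UNIV (sets borel)
     (\<lambda>A. \<Sum>j. ennreal (w (Suc j)) * emeasure (return borel (real (Suc j))) A)"

lemma space_dirac_series [simp]: "space (dirac_series w) = UNIV"
  by (simp add: dirac_series_def space_measure_of_conv)

lemma sets_dirac_series [simp, measurable_cong]: "sets (dirac_series w) = sets borel"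
  unfolding dirac_series_def using sets.sets_measure_of_eq[of "borel :: real measure"] by simp

lemma suminf_swap:
  fixes f :: "nat \<Rightarrow> nat \<Rightarrow> ennreal"
  shows "(\<Sum>i. \<Sum>j. f i j) = (\<Sum>j. \<Sum>i. f i j)"
  using nn_integral_suminf[of f "count_space UNIV"]
  by (simp add: nn_integral_count_space_nat)

lemma emeasure_dirac_series:
  assumes A: "A \<in> sets borel"
  shows "emeasure (dirac_series w) A =
    (\<Sum>j. ennreal (w (Suc j)) * emeasure (return borel (real (Suc j))) A)"
proof -
  let ?\<mu> = "\<lambda>A. \<Sum>j. ennreal (w (Suc j)) * emeasure (return borel (real (Suc j))) A"
  have pos: "positive (sets borel) ?\<mu>"
    by (simp add: positive_def)
  have ca: "countably_additive (sets borel) ?\<mu>"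
  proof (rule countably_additiveI)
    fix B :: "nat \<Rightarrow> real set"
    assume B: "range B \<subseteq> sets borel" "disjoint_family B" "(\<Union>i. B i) \<in> sets borel"
    have *: "(\<Sum>i. emeasure (return borel x) (B i)) = emeasure (return borel x) (\<Union>i. B i)"
      for x :: real
      using B by (intro suminf_emeasure) simp_all
    have "(\<Sum>i. ?\<mu> (B i)) =
        (\<Sum>j. \<Sum>i. ennreal (w (Suc j)) * emeasure (return borel (real (Suc j))) (B i))"
      by (rule suminf_swap)
    then show "(\<Sum>i. ?\<mu> (B i)) = ?\<mu> (\<Union>i. B i)"
      by (simp only: * ennreal_suminf_cmult)
  qed
  have "sigma_algebra (UNIV :: real set) (sets borel)"
    using sets.sigma_algebra_axioms[of "borel :: real measure"] by simp
  then show ?thesis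
    unfolding dirac_series_def using pos ca A by (rule emeasure_measure_of_sigma)
qed

definition distortion :: "real measure \<Rightarrow> real set \<Rightarrow> ennreal" where
  "distortion P \<alpha> = (\<integral>\<^sup>+ x. ennreal (Min ((\<lambda>a. \<bar>x - a\<bar>\<^sup>2) ` \<alpha>)) \<partial>P)"

definition quantization_error :: "real measure \<Rightarrow> nat \<Rightarrow> ennreal" where
  "quantization_error P n =
     (INF \<alpha> \<in> {\<alpha>. finite \<alpha> \<and> 1 \<le> card \<alpha> \<and> card \<alpha> \<le> n}. distortion P \<alpha>)"

definition optimal_n_means :: "real measure \<Rightarrow> nat \<Rightarrow> real set \<Rightarrow> bool" where
  "optimal_n_means P n \<alpha> \<longleftrightarrow>
     finite \<alpha> \<and> 1 \<le> card \<alpha> \<and> card \<alpha> \<le> n \<and> distortion P \<alpha> = quantization_error P n"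

definition Av :: "real measure \<Rightarrow> nat \<Rightarrow> nat \<Rightarrow> real" where
  "Av P i l = (\<Sum>m=i..l. measure P {real m} * real m) / (\<Sum>m=i..l. measure P {real m})"

definition Av_inf :: "real measure \<Rightarrow> nat \<Rightarrow> real" where
  "Av_inf P i = (\<Sum>m. measure P {real (i + m)} * real (i + m)) / (\<Sum>m. measure P {real (i + m)})"

definition conjecture_C :: bool where
  "conjecture_C \<longleftrightarrow>
     (\<forall>k\<ge>2. \<forall>p :: nat \<Rightarrow> real.
        bij_betw p {1..k - 1} ((\<lambda>i. 1 / 2 ^ i) ` {1..k - 1}) \<longrightarrow>
        (\<forall>n\<ge>k + 2. \<forall>a :: nat \<Rightarrow> real.
           strict_mono_on {1..n} a \<longrightarrow>
           optimal_n_means (dirac_series (\<lambda>j. if j < k then p j else 1 / 2 ^ j)) n (a ` {1..n}) \<longrightarrow>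
           (\<forall>i\<in>{1..n - 3}. a i = real i)))"

end

theory Submission
  imports Defs
begin

text \<open>
  The atom nearest to the left end and the atoms sharing its nearest point form a block; cutting
  the block off leaves a geometric tail with one point fewer. For the tail with weights
  \<open>1, 1/2, 1/4, \<dots>\<close> a block of two atoms costs \<open>1/3\<close> and a block of three costs \<open>13/14\<close>, which gives
  the minimal errors \<open>4\<close>, \<open>4/3\<close>, \<open>2/3\<close> for one, two and three points. For three points, first blocks of
  length one and two tie, whence the two optimal sets; every further point halves the error and must
  sit on the first atom. For the measure with the first two weights swapped, a block containing both 1
  and 2 costs at least \<open>1/6\<close> and one containing both 2 and 3 at least \<open>1/10\<close>, more than the error
  \<open>1/12\<close> attained with five points, so 1 and 2 are isolated and the geometric tail starts at 3.
\<close>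

section \<open>Squared distances to the nearest point\<close>

definition min_sq_dist :: "real set \<Rightarrow> real \<Rightarrow> real" where
  "min_sq_dist \<alpha> x = Min ((\<lambda>a. \<bar>x - a\<bar>\<^sup>2) ` \<alpha>)"

lemma min_sq_dist_le: "finite \<alpha> \<Longrightarrow> a \<in> \<alpha> \<Longrightarrow> min_sq_dist \<alpha> x \<le> (x - a)\<^sup>2"
  unfolding min_sq_dist_def by (rule Min_le) auto

lemma min_sq_dist_ge_iff:
  "finite \<alpha> \<Longrightarrow> \<alpha> \<noteq> {} \<Longrightarrow> y \<le> min_sq_dist \<alpha> x \<longleftrightarrow> (\<forall>a\<in>\<alpha>. y \<le> (x - a)\<^sup>2)"
  unfolding min_sq_dist_def by (subst Min_ge_iff) auto

lemma min_sq_dist_nonneg: "finite \<alpha> \<Longrightarrow> \<alpha> \<noteq> {} \<Longrightarrow> 0 \<le> min_sq_dist \<alpha> x"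
  by (simp add: min_sq_dist_ge_iff)

lemma min_sq_dist_attained:
  assumes "finite \<alpha>" "\<alpha> \<noteq> {}"
  obtains a where "a \<in> \<alpha>" "min_sq_dist \<alpha> x = (x - a)\<^sup>2"
proof -
  have "min_sq_dist \<alpha> x \<in> (\<lambda>a. \<bar>x - a\<bar>\<^sup>2) ` \<alpha>"
    unfolding min_sq_dist_def using assms by (intro Min_in) auto
  then show ?thesis using that by auto
qed

lemma min_sq_dist_antimono:
  assumes "finite \<alpha>" "\<beta> \<subseteq> \<alpha>" "\<beta> \<noteq> {}"
  shows "min_sq_dist \<alpha> x \<le> min_sq_dist \<beta> x"
  using assms by (auto simp: min_sq_dist_ge_iff finite_subset subset_iff intro!: min_sq_dist_le)

lemma min_sq_dist_singleton [simp]: "min_sq_dist {a} x = (x - a)\<^sup>2"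
  by (simp add: min_sq_dist_def)

text \<open>\<open>(y - b)\<^sup>2 - (y - a)\<^sup>2\<close> is affine in \<open>y\<close> with
  slope \<open>-2 * (b - a)\<close>, which is not positive, so an advantage of the right-hand point
  persists to the right.\<close>

lemma sq_dist_closer_mono:
  fixes a b x y :: real
  assumes "a \<le> b" "(x - b)\<^sup>2 \<le> (x - a)\<^sup>2" "x \<le> y"
  shows "(y - b)\<^sup>2 \<le> (y - a)\<^sup>2"
proof -
  have "(y - b)\<^sup>2 - (y - a)\<^sup>2 = ((x - b)\<^sup>2 - (x - a)\<^sup>2) - 2 * ((b - a) * (y - x))"
    by (simp add: power2_eq_square algebra_simps)
  moreover have "0 \<le> (b - a) * (y - x)" using assms by simp
  ultimately show ?thesis using assms by linarith
qed

text \<open>Take for \<open>a\<close> the rightmost of the points nearest to \<open>x\<close>: points to the left of \<open>a\<close> never matter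
  from \<open>x\<close> onwards, and once a point to the right of \<open>a\<close> is nearer, \<open>a\<close> never matters again.\<close>

lemma min_sq_dist_split:
  fixes x :: real
  assumes "finite \<alpha>" "\<alpha> \<noteq> {}"
  obtains (all) a where "a \<in> \<alpha>" "\<And>j. j < K \<Longrightarrow> (x + real j - a)\<^sup>2 \<le> min_sq_dist \<alpha> (x + real j)"
  | (split) a \<beta> L where "a \<in> \<alpha>" "\<beta> \<subseteq> \<alpha>" "\<beta> \<noteq> {}" "a \<notin> \<beta>" "1 \<le> L" "L < K"
      "\<And>j. j < L \<Longrightarrow> (x + real j - a)\<^sup>2 \<le> min_sq_dist \<alpha> (x + real j)"
      "\<And>j. L \<le> j \<Longrightarrow> min_sq_dist \<beta> (x + real j) \<le> min_sq_dist \<alpha> (x + real j)"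
proof -
  define S where "S = {a\<in>\<alpha>. (x - a)\<^sup>2 = min_sq_dist \<alpha> x}"
  have S: "finite S" "S \<noteq> {}"
  proof -
    show "finite S" using assms by (simp add: S_def)
    obtain a where "a \<in> \<alpha>" "min_sq_dist \<alpha> x = (x - a)\<^sup>2" using min_sq_dist_attained[OF assms] .
    then have "a \<in> S" by (simp add: S_def)
    then show "S \<noteq> {}" by blast
  qed
  \<comment> \<open>Breaking ties to the right makes every point of \<open>\<beta>\<close> strictly
    farther from \<open>x\<close> than \<open>a\<close>; this strictness later excludes
    \<open>L = 0\<close>.\<close>
  define a where "a = Max S"
  have aS: "a \<in> S" unfolding a_def using S by (rule Max_in)
  then have a: "a \<in> \<alpha>" "(x - a)\<^sup>2 = min_sq_dist \<alpha> x" by (auto simp: S_def)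
  define \<beta> where "\<beta> = {b\<in>\<alpha>. a < b}"
  have fb: "finite \<beta>" using assms by (simp add: \<beta>_def)
  have far: "(x - a)\<^sup>2 < (x - b)\<^sup>2" if "b \<in> \<beta>" for b
  proof -
    have "b \<notin> S" using that Max_ge[OF S(1), of b] by (auto simp: \<beta>_def a_def)
    then have "(x - b)\<^sup>2 \<noteq> min_sq_dist \<alpha> x" using that by (auto simp: S_def \<beta>_def)
    then show ?thesis using min_sq_dist_le[of \<alpha> b x] that assms a by (auto simp: \<beta>_def)
  qed
  have left: "(y - a)\<^sup>2 \<le> (y - c)\<^sup>2" if "c \<in> \<alpha>" "c \<le> a" "x \<le> y" for c y
    using sq_dist_closer_mono[OF that(2) _ that(3)] min_sq_dist_le[of \<alpha> c x] that assms a by auto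
  let ?Q = "\<lambda>j. \<exists>b\<in>\<beta>. (x + real j - b)\<^sup>2 < (x + real j - a)\<^sup>2"
  have near: "(x + real j - a)\<^sup>2 \<le> min_sq_dist \<alpha> (x + real j)" if "\<not> ?Q j" for j
    unfolding min_sq_dist_ge_iff[OF assms]
  proof
    fix c assume "c \<in> \<alpha>"
    then show "(x + real j - a)\<^sup>2 \<le> (x + real j - c)\<^sup>2"
      using that left[of c "x + real j"] by (cases "c \<le> a") (auto simp: \<beta>_def not_less)
  qed
  show thesis
  proof (cases "\<exists>j<K. ?Q j")
    case False
    then show ?thesis using all[OF a(1)] near by blast
  next
    case True
    define L where "L = (LEAST j. ?Q j)"
    obtain k where "?Q k" using True by blast
    then have Q: "?Q L" unfolding L_def by (rule LeastI[of ?Q])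
    have less: "\<not> ?Q j" if "j < L" for j
      using that unfolding L_def by (rule not_less_Least[of _ ?Q])
    have "L < K"
    proof -
      obtain k where k: "k < K" "?Q k" using True by blast
      then have "L \<le> k" unfolding L_def by (intro Least_le[of ?Q])
      then show ?thesis using k(1) by linarith
    qed
    moreover have "L \<noteq> 0"
    proof
      assume "L = 0"
      then obtain b where "b \<in> \<beta>" "(x - b)\<^sup>2 < (x - a)\<^sup>2" using Q by auto
      then show False using far[of b] by linarith
    qed
    moreover have "\<beta> \<noteq> {}" "\<beta> \<subseteq> \<alpha>" "a \<notin> \<beta>" using Q by (auto simp: \<beta>_def)
    moreover have "min_sq_dist \<beta> (x + real j) \<le> min_sq_dist \<alpha> (x + real j)" if "L \<le> j" for j
      unfolding min_sq_dist_ge_iff[OF assms]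
    proof
      fix c assume c: "c \<in> \<alpha>"
      \<comment> \<open>One witness serves every \<open>j \<ge> L\<close>: a point that beats
        \<open>a\<close> at \<open>L\<close> stays at least as near as \<open>a\<close> further
        right, and so does \<open>a\<close> compared with the points to its left.\<close>
      obtain b where b: "b \<in> \<beta>" "(x + real L - b)\<^sup>2 < (x + real L - a)\<^sup>2" using Q by blast
      show "min_sq_dist \<beta> (x + real j) \<le> (x + real j - c)\<^sup>2"
      proof (cases "c \<in> \<beta>")
        case True
        then show ?thesis by (rule min_sq_dist_le[OF fb])
      next
        case False
        have "(x + real j - b)\<^sup>2 \<le> (x + real j - a)\<^sup>2"
        proof (rule sq_dist_closer_mono)
          show "a \<le> b" using b(1) by (simp add: \<beta>_def)
          show "(x + real L - b)\<^sup>2 \<le> (x + real L - a)\<^sup>2" using b(2) by (rule less_imp_le)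
          show "x + real L \<le> x + real j" using that by simp
        qed
        also have "\<dots> \<le> (x + real j - c)\<^sup>2"
        proof (rule left[OF c])
          show "c \<le> a" using False c by (simp add: \<beta>_def)
        qed simp
        finally show ?thesis using min_sq_dist_le[OF fb b(1), of "x + real j"] by linarith
      qed
    qed
    ultimately show ?thesis
      by (intro split[of a \<beta> L] a(1) near less) simp_all
  qed
qed

section \<open>Distortion of a geometric tail\<close>

text \<open>The weights keep their total mass 2 and the start \<open>x\<close> is free, so that
  removing \<open>L\<close> atoms leads to the same function at \<open>x + L\<close>, scaled by
  \<open>1 / 2 ^ L\<close>.\<close>

definition geo_error :: "real \<Rightarrow> real set \<Rightarrow> real" where
  "geo_error x \<alpha> = (\<Sum>j. min_sq_dist \<alpha> (x + real j) / 2 ^ j)"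

text \<open>The last two sums are limits of closed forms for the partial sums, whose remainder is a
  polynomial of the summand's degree divided by \<open>2 ^ n\<close>.\<close>

lemma geo_moments:
  "(\<lambda>j. 1 / 2 ^ j :: real) sums 2"
  "(\<lambda>j. real j / 2 ^ j) sums 2"
  "(\<lambda>j. (real j)\<^sup>2 / 2 ^ j) sums 6"
proof -
  show 0: "(\<lambda>j. 1 / 2 ^ j :: real) sums 2"
    using geometric_sums[of "1/2::real"] by (simp add: power_one_over)
  have t1: "(\<lambda>n. 2 - (2 * real n + 2) / 2 ^ n) \<longlonglongrightarrow> 2" by real_asymp
  have "(\<Sum>j<n. real j / 2 ^ j) = 2 - (2 * real n + 2) / 2 ^ n" for n
  proof (induction n)
    case (Suc n)
    then show ?case unfolding sum.lessThan_Suc by (simp only:) (simp add: field_simps)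
  qed simp
  then show "(\<lambda>j. real j / 2 ^ j) sums 2" using t1 by (simp add: sums_def)
  have t2: "(\<lambda>n. 6 - (2 * (real n)\<^sup>2 + 4 * real n + 6) / 2 ^ n) \<longlonglongrightarrow> 6" by real_asymp
  have "(\<Sum>j<n. (real j)\<^sup>2 / 2 ^ j) = 6 - (2 * (real n)\<^sup>2 + 4 * real n + 6) / 2 ^ n" for n
  proof (induction n)
    case (Suc n)
    then show ?case
      unfolding sum.lessThan_Suc by (simp only:) (simp add: field_simps power2_eq_square)
  qed simp
  then show "(\<lambda>j. (real j)\<^sup>2 / 2 ^ j) sums 6" using t2 by (simp add: sums_def)
qed

text \<open>Parallel axis identity: the tail has mass 2, mean \<open>x + 1\<close> and second moment
  4 about its mean.\<close>

lemma sums_geo_error_singleton: "(\<lambda>j. (x + real j - a)\<^sup>2 / 2 ^ j) sums (4 + 2 * (x + 1 - a)\<^sup>2)"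
proof -
  have "(\<lambda>j. (x - a)\<^sup>2 * (1 / 2 ^ j) + 2 * (x - a) * (real j / 2 ^ j) + (real j)\<^sup>2 / 2 ^ j)
     sums ((x - a)\<^sup>2 * 2 + 2 * (x - a) * 2 + 6)"
    by (intro sums_add sums_mult geo_moments)
  moreover have "(x - a)\<^sup>2 * (1 / 2 ^ j) + 2 * (x - a) * (real j / 2 ^ j) + (real j)\<^sup>2 / 2 ^ j
      = (x + real j - a)\<^sup>2 / 2 ^ j" for j
    unfolding times_divide_eq_right add_divide_distrib[symmetric]
    by (rule arg_cong2[where f = "(/)"]) (simp_all add: power2_eq_square algebra_simps)
  moreover have "(x - a)\<^sup>2 * 2 + 2 * (x - a) * 2 + 6 = 4 + 2 * (x + 1 - a)\<^sup>2"
    by (simp add: power2_eq_square algebra_simps)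
  ultimately show ?thesis by (simp only:)
qed

lemma geo_error_singleton: "geo_error x {a} = 4 + 2 * (x + 1 - a)\<^sup>2"
  using sums_geo_error_singleton[of x a] by (simp add: geo_error_def sums_iff)

lemma summable_geo_error:
  assumes "finite \<alpha>" "\<alpha> \<noteq> {}"
  shows "summable (\<lambda>j. min_sq_dist \<alpha> (x + real j) / 2 ^ j)"
proof -
  obtain a where a: "a \<in> \<alpha>" using assms by blast
  show ?thesis
    using min_sq_dist_nonneg[OF assms] min_sq_dist_le[OF assms(1) a]
    by (intro summable_comparison_test'[OF sums_summable[OF sums_geo_error_singleton[of x a]], of 0])
       (simp add: divide_right_mono)
qed

lemma geo_error_shift:
  assumes "finite \<alpha>" "\<alpha> \<noteq> {}"
  shows "geo_error x \<alpha> = (\<Sum>j<L. min_sq_dist \<alpha> (x + real j) / 2 ^ j) + geo_error (x + real L) \<alpha> / 2 ^ L"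
proof -
  have "geo_error x \<alpha> = (\<Sum>j<L. min_sq_dist \<alpha> (x + real j) / 2 ^ j)
      + (\<Sum>j. min_sq_dist \<alpha> (x + real (j + L)) / 2 ^ (j + L))"
    unfolding geo_error_def using suminf_split_initial_segment[OF summable_geo_error[OF assms], of x L]
    by simp
  also have "(\<Sum>j. min_sq_dist \<alpha> (x + real (j + L)) / 2 ^ (j + L))
      = (\<Sum>j. min_sq_dist \<alpha> (x + real L + real j) / 2 ^ j / 2 ^ L)"
    by (simp add: power_add algebra_simps)
  also have "\<dots> = geo_error (x + real L) \<alpha> / 2 ^ L"
    unfolding geo_error_def by (rule suminf_divide[OF summable_geo_error[OF assms]])
  finally show ?thesis .
qed

lemma geo_error_nonneg: "finite \<alpha> \<Longrightarrow> \<alpha> \<noteq> {} \<Longrightarrow> 0 \<le> geo_error x \<alpha>"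
  unfolding geo_error_def
  by (intro suminf_nonneg summable_geo_error) (simp_all add: min_sq_dist_nonneg)

lemma geo_error_mono:
  assumes "finite \<alpha>" "\<alpha> \<noteq> {}" "finite \<beta>" "\<beta> \<noteq> {}"
    and "\<And>j. min_sq_dist \<alpha> (x + real j) \<le> min_sq_dist \<beta> (x + real j)"
  shows "geo_error x \<alpha> \<le> geo_error x \<beta>"
  unfolding geo_error_def
  using assms by (intro suminf_le summable_geo_error) (simp_all add: divide_right_mono)

text \<open>Serving the first \<open>L\<close> atoms by \<open>a\<close> and the others by
  \<open>\<beta>\<close> is one possible assignment, and nearest points cost no more.\<close>

lemma geo_error_insert_le:
  assumes "finite \<beta>" "\<beta> \<noteq> {}"
  shows "geo_error x (insert a \<beta>)
    \<le> (\<Sum>j<L. (x + real j - a)\<^sup>2 / 2 ^ j) + geo_error (x + real L) \<beta> / 2 ^ L"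
proof -
  have "geo_error (x + real L) (insert a \<beta>) \<le> geo_error (x + real L) \<beta>"
    using assms by (intro geo_error_mono min_sq_dist_antimono) auto
  then show ?thesis
    using assms unfolding geo_error_shift[of "insert a \<beta>" x L, OF finite.insertI[OF assms(1)] insert_not_empty]
    by (intro add_mono sum_mono divide_right_mono min_sq_dist_le) auto
qed

text \<open>Lower-bound counterpart of \<open>geo_error_insert_le\<close>. \<open>K\<close> is to be
  chosen so large that one block of \<open>K\<close> atoms is already too expensive; then only the
  block lengths below \<open>K\<close> remain.\<close>

lemma geo_error_split:
  assumes "finite \<alpha>" "\<alpha> \<noteq> {}"
  obtains (all) a where "a \<in> \<alpha>" "(\<Sum>j<K. (x + real j - a)\<^sup>2 / 2 ^ j) \<le> geo_error x \<alpha>"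
  | (split) a \<beta> L where "finite \<beta>" "\<beta> \<noteq> {}" "insert a \<beta> \<subseteq> \<alpha>" "a \<notin> \<beta>" "1 \<le> L" "L < K"
      "(\<Sum>j<L. (x + real j - a)\<^sup>2 / 2 ^ j) + geo_error (x + real L) \<beta> / 2 ^ L \<le> geo_error x \<alpha>"
  using assms
proof (cases rule: min_sq_dist_split[where K = K and x = x])
  case (all a)
  have "(\<Sum>j<K. (x + real j - a)\<^sup>2 / 2 ^ j) \<le> (\<Sum>j<K. min_sq_dist \<alpha> (x + real j) / 2 ^ j)"
    using all by (intro sum_mono divide_right_mono) auto
  also have "\<dots> \<le> geo_error x \<alpha>"
    unfolding geo_error_shift[OF assms, of x K] using geo_error_nonneg[OF assms] by simp
  finally show ?thesis using that(1) all(1) by blast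
next
  case (split a \<beta> L)
  have fb: "finite \<beta>" using split assms finite_subset by blast
  have "geo_error (x + real L) \<beta> \<le> geo_error (x + real L) \<alpha>"
    using split(8)[of "L + _"] by (intro geo_error_mono assms fb split(3)) (simp add: algebra_simps)
  then have "(\<Sum>j<L. (x + real j - a)\<^sup>2 / 2 ^ j) + geo_error (x + real L) \<beta> / 2 ^ L \<le> geo_error x \<alpha>"
    unfolding geo_error_shift[OF assms, of x L]
    using split(7) by (intro add_mono sum_mono divide_right_mono) auto
  then show ?thesis using that(2)[of \<beta> a L] fb split by auto
qed

text \<open>The constant on the right is the weighted variance of the block of 2, 3 or 4 atoms.\<close>

lemma block_costs:
  fixes y :: real
  shows "y\<^sup>2 + (y + 1)\<^sup>2 / 2 = 1/3 + 3/2 * (y + 1/3)\<^sup>2"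
    "y\<^sup>2 + (y + 1)\<^sup>2 / 2 + (y + 2)\<^sup>2 / 4 = 13/14 + 7/4 * (y + 4/7)\<^sup>2"
    "y\<^sup>2 + (y + 1)\<^sup>2 / 2 + (y + 2)\<^sup>2 / 4 + (y + 3)\<^sup>2 / 8 = 97/60 + 15/8 * (y + 11/15)\<^sup>2"
  by (simp_all add: power2_eq_square field_simps)

lemma block_sums:
  fixes x a :: real
  shows "(\<Sum>j<Suc 0. (x + real j - a)\<^sup>2 / 2 ^ j) = (x - a)\<^sup>2"
    "(\<Sum>j<2. (x + real j - a)\<^sup>2 / 2 ^ j) = 1/3 + 3/2 * (x + 1/3 - a)\<^sup>2"
    "(\<Sum>j<3. (x + real j - a)\<^sup>2 / 2 ^ j) = 13/14 + 7/4 * (x + 4/7 - a)\<^sup>2"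
    "(\<Sum>j<4. (x + real j - a)\<^sup>2 / 2 ^ j) = 97/60 + 15/8 * (x + 11/15 - a)\<^sup>2"
  using block_costs[of "x - a"] by (simp_all add: numeral_eq_Suc algebra_simps)

text \<open>For the equality cases: there \<open>\<beta>\<close> uses up all available points but
  one, so \<open>\<alpha>\<close> has none besides \<open>a\<close> and
  \<open>\<beta>\<close>.\<close>

lemma card_insert_subset_eq:
  assumes "insert a \<beta> \<subseteq> \<alpha>" "a \<notin> \<beta>" "finite \<alpha>" "card \<alpha> \<le> Suc (card \<beta>)"
  shows "\<alpha> = insert a \<beta>"
  using assms card_seteq[of \<alpha> "insert a \<beta>"] finite_subset[of \<beta> \<alpha>] by auto

lemma card_le_of_insert_subset:
  assumes "insert a \<beta> \<subseteq> \<alpha>" "a \<notin> \<beta>" "finite \<alpha>" "card \<alpha> \<le> Suc n"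
  shows "card \<beta> \<le> n"
  using assms card_mono[of \<alpha> "insert a \<beta>"] finite_subset[of \<beta> \<alpha>] by auto

section \<open>Minimal errors for one and two points\<close>

lemma geo_error_one:
  assumes "finite \<alpha>" "\<alpha> \<noteq> {}" "card \<alpha> \<le> 1"
  shows "4 \<le> geo_error x \<alpha> \<and> (geo_error x \<alpha> \<le> 4 \<longrightarrow> card \<alpha> = 1 \<and> \<alpha> = {x + 1})"
proof -
  have "card \<alpha> = 1" using assms by (simp add: le_Suc_eq)
  then obtain a where "\<alpha> = {a}" by (auto simp: card_1_singleton_iff)
  then show ?thesis by (auto simp: geo_error_singleton)
qed

text \<open>With one point left for the rest, first blocks of length 1, 2 and 3 lead to at least
  \<open>4/2 = 2\<close>, \<open>1/3 + 4/4 = 4/3\<close> and \<open>13/14 + 4/8 = 10/7\<close>, so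
  length 2 wins. \<open>K = 4\<close> works since \<open>97/60 > 4/3\<close>, whereas
  \<open>13/14 < 4/3\<close>.\<close>

lemma geo_error_two:
  assumes "finite \<alpha>" "\<alpha> \<noteq> {}" "card \<alpha> \<le> 2"
  shows "4/3 \<le> geo_error x \<alpha> \<and> (geo_error x \<alpha> \<le> 4/3 \<longrightarrow> card \<alpha> = 2 \<and> \<alpha> = {x + 1/3, x + 3})"
  using assms(1,2)
proof (cases rule: geo_error_split[where K = 4 and x = x])
  case (all a)
  then show ?thesis unfolding block_sums using zero_le_power2[of "x + 11/15 - a"] by linarith
next
  case (split a \<beta> L)
  have "card \<beta> \<le> 1"
    using card_le_of_insert_subset[OF split(3,4) assms(1)] assms(3) by simp
  from geo_error_one[OF split(1,2) this]
  have one: "4 \<le> geo_error y \<beta>" "geo_error y \<beta> \<le> 4 \<Longrightarrow> card \<beta> = 1 \<and> \<beta> = {y + 1}" for y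
    by auto
  consider "L = Suc 0" | "L = 2" | "L = 3" using split(5,6) by linarith
  then show ?thesis
  proof cases
    case 1
    then have "(x - a)\<^sup>2 + geo_error (x + 1) \<beta> / 2 \<le> geo_error x \<alpha>"
      using split(7) by (simp add: block_sums)
    then show ?thesis using one(1)[of "x + 1"] zero_le_power2[of "x - a"] by linarith
  next
    case 2
    have le: "1/3 + 3/2 * (x + 1/3 - a)\<^sup>2 + geo_error (x + 2) \<beta> / 4 \<le> geo_error x \<alpha>"
      using split(7) 2 by (simp add: block_sums)
    have ge: "4/3 \<le> geo_error x \<alpha>"
      using le one(1)[of "x + 2"] zero_le_power2[of "x + 1/3 - a"] by linarith
    have "card \<alpha> = 2 \<and> \<alpha> = {x + 1/3, x + 3}" if "geo_error x \<alpha> \<le> 4/3"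
    proof -
      have "(x + 1/3 - a)\<^sup>2 \<le> 0" using le one(1)[of "x + 2"] that by linarith
      then have a: "a = x + 1/3" by simp
      have "geo_error (x + 2) \<beta> \<le> 4" using le zero_le_power2[of "x + 1/3 - a"] that by linarith
      then have b: "card \<beta> = 1" "\<beta> = {x + 3}" using one(2)[of "x + 2"] by auto
      have "\<alpha> = insert a \<beta>" using card_insert_subset_eq[OF split(3,4) assms(1)] b assms(3) by simp
      then show ?thesis using a b split(4) by auto
    qed
    then show ?thesis using ge by blast
  next
    case 3
    then have "13/14 + 7/4 * (x + 4/7 - a)\<^sup>2 + geo_error (x + 3) \<beta> / 8 \<le> geo_error x \<alpha>"
      using split(7) by (simp add: block_sums)
    then show ?thesis using one(1)[of "x + 3"] zero_le_power2[of "x + 4/7 - a"] by linarith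
  qed
qed

section \<open>Candidate optimal sets for the tail\<close>

text \<open>After \<open>m\<close> isolated atoms come the mean of a block of two and the mean of
  the tail starting at \<open>x + m + 2\<close>.\<close>

definition two_pattern :: "real \<Rightarrow> nat \<Rightarrow> real set" where
  "two_pattern x m = (\<lambda>j. x + real j) ` {..<m} \<union> {x + real m + 1/3, x + real m + 3}"

text \<open>Here two blocks of two atoms precede the tail, which starts at \<open>x + m + 4\<close>.
  The number of points, \<open>m + 3\<close>, is that of
  \<open>two_pattern x (Suc m)\<close>.\<close>

definition three_pattern :: "real \<Rightarrow> nat \<Rightarrow> real set" where
  "three_pattern x m =
    (\<lambda>j. x + real j) ` {..<m} \<union> {x + real m + 1/3, x + real m + 2 + 1/3, x + real m + 5}"

lemma image_shift_Suc:
  "(\<lambda>j. x + real j) ` {..<Suc m} = insert x ((\<lambda>j. x + 1 + real j) ` {..<m})"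
  unfolding lessThan_Suc_eq_insert_0 by (auto simp: image_image add_ac)

lemma two_pattern_Suc: "two_pattern x (Suc m) = insert x (two_pattern (x + 1) m)"
  unfolding two_pattern_def image_shift_Suc by (auto simp: algebra_simps)

lemma three_pattern_Suc: "three_pattern x (Suc m) = insert x (three_pattern (x + 1) m)"
  unfolding three_pattern_def image_shift_Suc by (auto simp: algebra_simps)

lemma finite_patterns [simp]: "finite (two_pattern x m)" "finite (three_pattern x m)"
  and patterns_nonempty [simp]: "two_pattern x m \<noteq> {}" "three_pattern x m \<noteq> {}"
  by (auto simp: two_pattern_def three_pattern_def)

text \<open>The start costs \<open>1/3 + 4/4 = 4/3\<close>, and every isolated atom in front halves
  the error.\<close>

lemma two_pattern_error: "geo_error x (two_pattern x m) \<le> 4 / (3 * 2 ^ m)"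
proof (induction m arbitrary: x)
  case 0
  have "geo_error x (insert (x + 1/3) {x + 3}) \<le> 4/3"
    using geo_error_insert_le[of "{x + 3}" x "x + 1/3" 2]
    by (simp only: block_sums geo_error_singleton) simp
  then show ?case by (simp add: two_pattern_def)
next
  case (Suc m)
  have "geo_error x (two_pattern x (Suc m)) \<le> geo_error (x + 1) (two_pattern (x + 1) m) / 2"
    unfolding two_pattern_Suc
    by (rule order_trans[OF geo_error_insert_le[where L = "Suc 0"]]) (simp_all add: block_sums)
  also have "\<dots> \<le> 4 / (3 * 2 ^ m) / 2" using Suc[of "x + 1"] by (intro divide_right_mono) simp_all
  finally show ?case by (simp add: ac_simps)
qed

text \<open>The start costs \<open>1/3 + (4/3) / 4 = 2/3\<close>, a tie with
  \<open>two_pattern x (Suc 0)\<close>.\<close>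

lemma three_pattern_error: "geo_error x (three_pattern x m) \<le> 2 / (3 * 2 ^ m)"
proof (induction m arbitrary: x)
  case 0
  have eq: "three_pattern x 0 = insert (x + 1/3) (two_pattern (x + 2) 0)"
    by (simp add: three_pattern_def two_pattern_def add_ac)
  have "geo_error x (three_pattern x 0) \<le> 1/3 + geo_error (x + 2) (two_pattern (x + 2) 0) / 4"
    using geo_error_insert_le[of "two_pattern (x + 2) 0" x "x + 1/3" 2]
    unfolding eq block_sums by simp
  then show ?case using two_pattern_error[of "x + 2" 0] by simp
next
  case (Suc m)
  have "geo_error x (three_pattern x (Suc m)) \<le> geo_error (x + 1) (three_pattern (x + 1) m) / 2"
    unfolding three_pattern_Suc
    by (rule order_trans[OF geo_error_insert_le[where L = "Suc 0"]]) (simp_all add: block_sums)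
  also have "\<dots> \<le> 2 / (3 * 2 ^ m) / 2" using Suc[of "x + 1"] by (intro divide_right_mono) simp_all
  finally show ?case by (simp add: ac_simps)
qed

section \<open>Lower bound and equality cases for three or more points\<close>

text \<open>Induction on the number of points beyond three. Only the base case has a tie between
  block lengths; afterwards the first atom must be isolated, so the same two shapes recur with one
  more isolated atom.\<close>

lemma geo_error_lower_bound:
  assumes "finite \<alpha>" "\<alpha> \<noteq> {}" "card \<alpha> \<le> m + 3"
  shows "2 / (3 * 2 ^ m) \<le> geo_error x \<alpha> \<and> (geo_error x \<alpha> \<le> 2 / (3 * 2 ^ m) \<longrightarrow>
    card \<alpha> = m + 3 \<and> \<alpha> \<in> {two_pattern x (Suc m), three_pattern x m})"
  using assms
proof (induction m arbitrary: x \<alpha>)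
  case 0
  from 0(1,2) show ?case
  proof (cases rule: geo_error_split[where K = 3 and x = x])
    case (all a)
    then have "2/3 < geo_error x \<alpha>"
      unfolding block_sums using zero_le_power2[of "x + 4/7 - a"] by linarith
    then show ?thesis by simp
  next
    case (split a \<beta> L)
    have cb: "card \<beta> \<le> 2"
      using card_le_of_insert_subset[OF split(3,4) 0(1)] 0(3) by simp
    from geo_error_two[OF split(1,2) this]
    have two: "4/3 \<le> geo_error y \<beta>"
      "geo_error y \<beta> \<le> 4/3 \<Longrightarrow> card \<beta> = 2 \<and> \<beta> = {y + 1/3, y + 3}" for y
      by auto
    have \<alpha>: "card \<alpha> = 3 \<and> \<alpha> = insert a \<beta>" if "card \<beta> = 2"
      using card_insert_subset_eq[OF split(3,4) 0(1)] split(1,4) that 0(3) by simp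
    \<comment> \<open>Length 1 leads to \<open>(4/3) / 2\<close> and length 2 to
      \<open>1/3 + (4/3) / 4\<close>. Both equal \<open>2/3\<close>, and each leaves no slack in the
      position of \<open>a\<close> or in \<open>\<beta>\<close>.\<close>
    consider "L = Suc 0" | "L = 2" using split(5,6) by linarith
    then show ?thesis
    proof cases
      case 1
      have le: "(x - a)\<^sup>2 + geo_error (x + 1) \<beta> / 2 \<le> geo_error x \<alpha>"
        using split(7) 1 by (simp add: block_sums)
      have ge: "2/3 \<le> geo_error x \<alpha>"
        using le two(1)[of "x + 1"] zero_le_power2[of "x - a"] by linarith
      have "card \<alpha> = 3 \<and> \<alpha> = two_pattern x (Suc 0)" if "geo_error x \<alpha> \<le> 2/3"
      proof -
        have "(x - a)\<^sup>2 \<le> 0" using le two(1)[of "x + 1"] that by linarith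
        then have a: "a = x" by simp
        have "geo_error (x + 1) \<beta> \<le> 4/3" using le zero_le_power2[of "x - a"] that by linarith
        then have "card \<beta> = 2" "\<beta> = {x + 1 + 1/3, x + 1 + 3}" using two(2)[of "x + 1"] by auto
        then show ?thesis using \<alpha> a by (auto simp: two_pattern_def)
      qed
      then show ?thesis using ge by simp
    next
      case 2
      have le: "1/3 + 3/2 * (x + 1/3 - a)\<^sup>2 + geo_error (x + 2) \<beta> / 4 \<le> geo_error x \<alpha>"
        using split(7) 2 by (simp add: block_sums)
      have ge: "2/3 \<le> geo_error x \<alpha>"
        using le two(1)[of "x + 2"] zero_le_power2[of "x + 1/3 - a"] by linarith
      have "card \<alpha> = 3 \<and> \<alpha> = three_pattern x 0" if "geo_error x \<alpha> \<le> 2/3"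
      proof -
        have "(x + 1/3 - a)\<^sup>2 \<le> 0" using le two(1)[of "x + 2"] that by linarith
        then have a: "a = x + 1/3" by simp
        have "geo_error (x + 2) \<beta> \<le> 4/3"
          using le zero_le_power2[of "x + 1/3 - a"] that by linarith
        then have "card \<beta> = 2" "\<beta> = {x + 2 + 1/3, x + 2 + 3}" using two(2)[of "x + 2"] by auto
        then show ?thesis using \<alpha> a by (auto simp: three_pattern_def)
      qed
      then show ?thesis using ge by simp
    qed
  qed
next
  case (Suc m)
  \<comment> \<open>\<open>g\<close> is the minimal error for one point fewer and
    \<open>g / 2\<close> the target; the bound \<open>g \<le> 2/3\<close> is enough to exclude
    longer first blocks.\<close>
  define g :: real where "g = 2 / (3 * 2 ^ m)"
  have g: "2 / (3 * 2 ^ Suc m) = g / 2" "0 < g" "g \<le> 2/3"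
    by (simp_all add: g_def field_simps)
  from Suc.prems(1,2) show ?case unfolding g(1)
  proof (cases rule: geo_error_split[where K = 3 and x = x])
    case (all a)
    then show "g / 2 \<le> geo_error x \<alpha> \<and> (geo_error x \<alpha> \<le> g / 2 \<longrightarrow> card \<alpha> = Suc m + 3
        \<and> \<alpha> \<in> {two_pattern x (Suc (Suc m)), three_pattern x (Suc m)})"
      unfolding block_sums using zero_le_power2[of "x + 4/7 - a"] g by linarith
  next
    case (split a \<beta> L)
    have cb: "card \<beta> \<le> m + 3"
      using card_le_of_insert_subset[OF split(3,4) Suc.prems(1)] Suc.prems(3) by simp
    from Suc.IH[OF split(1,2) this]
    have IH: "g \<le> geo_error y \<beta>" "geo_error y \<beta> \<le> g \<Longrightarrow>
        card \<beta> = m + 3 \<and> \<beta> \<in> {two_pattern y (Suc m), three_pattern y m}" for y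
      unfolding g_def by auto
    consider "L = Suc 0" | "L = 2" using split(5,6) by linarith
    then show "g / 2 \<le> geo_error x \<alpha> \<and> (geo_error x \<alpha> \<le> g / 2 \<longrightarrow> card \<alpha> = Suc m + 3
        \<and> \<alpha> \<in> {two_pattern x (Suc (Suc m)), three_pattern x (Suc m)})"
    proof cases
      case 1
      have le: "(x - a)\<^sup>2 + geo_error (x + 1) \<beta> / 2 \<le> geo_error x \<alpha>"
        using split(7) 1 by (simp add: block_sums)
      have ge: "g / 2 \<le> geo_error x \<alpha>"
        using le IH(1)[of "x + 1"] zero_le_power2[of "x - a"] by linarith
      have "card \<alpha> = Suc m + 3 \<and> \<alpha> \<in> {two_pattern x (Suc (Suc m)), three_pattern x (Suc m)}"
        if "geo_error x \<alpha> \<le> g / 2"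
      proof -
        have "(x - a)\<^sup>2 \<le> 0" using le IH(1)[of "x + 1"] that by linarith
        then have a: "a = x" by simp
        have "geo_error (x + 1) \<beta> \<le> g" using le zero_le_power2[of "x - a"] that by linarith
        then have b: "card \<beta> = m + 3" "\<beta> \<in> {two_pattern (x + 1) (Suc m), three_pattern (x + 1) m}"
          using IH(2)[of "x + 1"] by auto
        have \<alpha>: "\<alpha> = insert a \<beta>"
          using card_insert_subset_eq[OF split(3,4) Suc.prems(1)] b(1) Suc.prems(3) by simp
        have "card \<alpha> = Suc m + 3" using \<alpha> b(1) split(1,4) by simp
        moreover have "\<alpha> \<in> {two_pattern x (Suc (Suc m)), three_pattern x (Suc m)}"
          using \<alpha> a b(2) by (metis insert_iff singletonD two_pattern_Suc three_pattern_Suc)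
        ultimately show ?thesis by blast
      qed
      then show ?thesis using ge by blast
    next
      case 2
      \<comment> \<open>\<open>1/3 + g/4 > g/2\<close> whenever \<open>g < 4/3\<close>, so a first
        block of two is no longer optimal.\<close>
      have "1/3 + 3/2 * (x + 1/3 - a)\<^sup>2 + geo_error (x + 2) \<beta> / 4 \<le> geo_error x \<alpha>"
        using split(7) 2 by (simp add: block_sums)
      then show ?thesis using IH(1)[of "x + 2"] zero_le_power2[of "x + 1/3 - a"] g by linarith
    qed
  qed
qed

section \<open>The measure with the first two weights swapped\<close>

definition swapped_error :: "real set \<Rightarrow> real" where
  "swapped_error \<alpha> = min_sq_dist \<alpha> 1 / 4 + min_sq_dist \<alpha> 2 / 2 + geo_error 3 \<alpha> / 8"

text \<open>Of the \<open>m + 5\<close> points two are spent on the atoms 1 and 2, which leaves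
  \<open>m + 3\<close> for the tail and reduces the claim to
  \<open>geo_error_lower_bound\<close>.\<close>

lemma swapped_error_lower_bound:
  assumes "finite \<alpha>" "\<alpha> \<noteq> {}" "card \<alpha> \<le> m + 5"
  shows "1 / (12 * 2 ^ m) \<le> swapped_error \<alpha> \<and> (swapped_error \<alpha> \<le> 1 / (12 * 2 ^ m) \<longrightarrow>
    \<alpha> \<in> {insert 1 (insert 2 (two_pattern 3 (Suc m))), insert 1 (insert 2 (three_pattern 3 m))})"
proof -
  define g :: real where "g = 2 / (3 * 2 ^ m)"
  have g: "1 / (12 * 2 ^ m) = g / 8" "0 < g" "g \<le> 2/3"
    by (simp_all add: g_def field_simps)
  \<comment> \<open>Squares are completed at the weighted means \<open>5/3\<close> of the atoms 1, 2
    and \<open>11/5\<close> of the atoms 2, 3. The minima \<open>1/6\<close> and \<open>1/10\<close>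
    both exceed \<open>g / 8\<close>, which is at most \<open>1/12\<close>.\<close>
  have "(1 - a)\<^sup>2 / 4 + (2 - a)\<^sup>2 / 2 = 1/6 + 3/4 * (a - 5/3)\<^sup>2"
    "(2 - a)\<^sup>2 / 2 + (3 - a)\<^sup>2 / 8 = 1/10 + 5/8 * (a - 11/5)\<^sup>2" for a :: real
    by (simp_all add: power2_eq_square field_simps)
  then have blocks: "1/6 \<le> (1 - a)\<^sup>2 / 4 + (2 - a)\<^sup>2 / 2"
    "1/10 \<le> (2 - a)\<^sup>2 / 2 + (3 - a)\<^sup>2 / 8" for a :: real
    by simp_all
  have "g / 8 \<le> swapped_error \<alpha> \<and> (swapped_error \<alpha> \<le> g / 8 \<longrightarrow>
    \<alpha> \<in> {insert 1 (insert 2 (two_pattern 3 (Suc m))), insert 1 (insert 2 (three_pattern 3 m))})"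
    using assms(1,2)
  \<comment> \<open>The weights increase from atom 1 to atom 2, so the split is made on distances
    instead of \<open>geo_error\<close>; \<open>K = 2\<close> leaves only
    \<open>L = 1\<close>.\<close>
  proof (cases rule: min_sq_dist_split[where K = 2 and x = 1])
    case (all a)
    have "(1 - a)\<^sup>2 / 4 + (2 - a)\<^sup>2 / 2 \<le> swapped_error \<alpha>"
      unfolding swapped_error_def
      using all(2)[of 0] all(2)[of 1] geo_error_nonneg[OF assms(1,2), of 3] by simp
    then show ?thesis using blocks(1)[of a] g by linarith
  next
    case (split a \<beta> L)
    have L: "L = 1" using split by simp
    have fb: "finite \<beta>" using split assms finite_subset by blast
    have "geo_error 3 \<beta> \<le> geo_error 3 \<alpha>"
      using split(8)[of "2 + _"] L by (intro geo_error_mono fb assms split) (simp add: algebra_simps)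
    then have le1: "(1 - a)\<^sup>2 / 4 + min_sq_dist \<beta> 2 / 2 + geo_error 3 \<beta> / 8 \<le> swapped_error \<alpha>"
      unfolding swapped_error_def using split(7)[of 0] split(8)[of 1] L by simp
    from fb split(3) show ?thesis
    proof (cases rule: min_sq_dist_split[where K = 2 and x = 2])
      case (all b)
      have "min_sq_dist \<beta> 3 \<le> geo_error 3 \<beta>"
        using geo_error_shift[OF fb split(3), of 3 "Suc 0"] geo_error_nonneg[OF fb split(3), of "3 + 1"]
        by simp
      then have "(1 - a)\<^sup>2 / 4 + (2 - b)\<^sup>2 / 2 + (3 - b)\<^sup>2 / 8 \<le> swapped_error \<alpha>"
        using le1 all(2)[of 0] all(2)[of 1] by simp
      then show ?thesis using blocks(2)[of b] zero_le_power2[of "1 - a"] g by linarith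
    next
      case c: (split b \<gamma> M)
      have M: "M = 1" using c by simp
      have fc: "finite \<gamma>" using c fb finite_subset by blast
      have "geo_error 3 \<gamma> \<le> geo_error 3 \<beta>"
        using c(8)[of "1 + _"] M by (intro geo_error_mono fb fc c split) (simp add: algebra_simps)
      then have le: "(1 - a)\<^sup>2 / 4 + (2 - b)\<^sup>2 / 2 + geo_error 3 \<gamma> / 8 \<le> swapped_error \<alpha>"
        using le1 c(7)[of 0] M by simp
      have sub: "insert a \<beta> \<subseteq> \<alpha>" "insert b \<gamma> \<subseteq> \<beta>" using split c by auto
      have cb: "card \<beta> \<le> m + 4"
        using card_le_of_insert_subset[OF sub(1) split(4) assms(1)] assms(3) by simp
      have cc: "card \<gamma> \<le> m + 3"
        using card_le_of_insert_subset[OF sub(2) c(4) fb] cb by simp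
      note low = geo_error_lower_bound[OF fc c(3) cc, of 3, folded g_def]
      have ge: "g / 8 \<le> swapped_error \<alpha>"
        using le low zero_le_power2[of "1 - a"] zero_le_power2[of "2 - b"] by linarith
      have "\<alpha> \<in> {insert 1 (insert 2 (two_pattern 3 (Suc m))), insert 1 (insert 2 (three_pattern 3 m))}"
        if "swapped_error \<alpha> \<le> g / 8"
      proof -
        have "(1 - a)\<^sup>2 \<le> 0" using le low zero_le_power2[of "2 - b"] that by linarith
        then have a: "a = 1" by simp
        have "(2 - b)\<^sup>2 \<le> 0" using le low zero_le_power2[of "1 - a"] that by linarith
        then have b: "b = 2" by simp
        have "geo_error 3 \<gamma> \<le> g"
          using le zero_le_power2[of "1 - a"] zero_le_power2[of "2 - b"] that by linarith
        then have \<gamma>: "card \<gamma> = m + 3" "\<gamma> \<in> {two_pattern 3 (Suc m), three_pattern 3 m}"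
          using low by auto
        have \<beta>: "\<beta> = insert b \<gamma>" using card_insert_subset_eq[OF sub(2) c(4) fb] \<gamma>(1) cb by simp
        have "card \<beta> = m + 4" using \<beta> \<gamma>(1) c(4) fc by simp
        then have "\<alpha> = insert a \<beta>"
          using card_insert_subset_eq[OF sub(1) split(4) assms(1)] assms(3) by simp
        then show ?thesis using \<beta> \<gamma>(2) a b by auto
      qed
      then show ?thesis using ge by blast
    qed
  qed
  then show ?thesis unfolding g(1) .
qed

lemma swapped_error_insert_le:
  assumes "finite \<gamma>" "\<gamma> \<noteq> {}"
  shows "swapped_error (insert 1 (insert 2 \<gamma>)) \<le> geo_error 3 \<gamma> / 8"
proof -
  have "geo_error 3 (insert 1 (insert 2 \<gamma>)) \<le> geo_error 3 \<gamma>"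
    using assms by (intro geo_error_mono min_sq_dist_antimono) auto
  moreover have "min_sq_dist (insert 1 (insert 2 \<gamma>)) 1 \<le> (1 - 1)\<^sup>2"
    "min_sq_dist (insert 1 (insert 2 \<gamma>)) 2 \<le> (2 - 2)\<^sup>2"
    using assms by (intro min_sq_dist_le; simp)+
  ultimately show ?thesis unfolding swapped_error_def by simp
qed

section \<open>Integration against a series of Dirac measures\<close>

text \<open>As the image of a weighted counting measure, the series measure has integrals that
  reduce to sums by the rules for \<open>distr\<close> and \<open>density\<close>.\<close>

lemma dirac_series_eq_distr:
  "dirac_series w = distr (density (count_space UNIV) (\<lambda>j. ennreal (w (Suc j)))) borel (\<lambda>j. real (Suc j))"
proof (rule measure_eqI)
  fix A assume "A \<in> sets (dirac_series w)"
  then have A: "A \<in> sets borel" by simp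
  show "emeasure (dirac_series w) A =
      emeasure (distr (density (count_space UNIV) (\<lambda>j. ennreal (w (Suc j)))) borel (\<lambda>j. real (Suc j))) A"
    using A by (simp add: emeasure_dirac_series emeasure_distr emeasure_density
        nn_integral_count_space_nat indicator_def vimage_def)
qed simp

lemma nn_integral_dirac_series:
  assumes [measurable]: "f \<in> borel_measurable borel"
  shows "(\<integral>\<^sup>+ x. f x \<partial>dirac_series w) = (\<Sum>j. ennreal (w (Suc j)) * f (real (Suc j)))"
  unfolding dirac_series_eq_distr
  by (simp add: nn_integral_distr nn_integral_density nn_integral_count_space_nat)

lemma measure_dirac_series:
  assumes "0 < m" "0 \<le> w m"
  shows "measure (dirac_series w) {real m} = w m"
proof -
  have "emeasure (dirac_series w) {real m} =
      (\<Sum>j. ennreal (w (Suc j)) * indicator {real m} (real (Suc j)))"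
    by (simp add: emeasure_dirac_series)
  \<comment> \<open>The series starts at atom 1, so atom \<open>m\<close> has index
    \<open>m - 1\<close>.\<close>
  also have "\<dots> = (\<Sum>j\<in>{m - 1}. ennreal (w (Suc j)) * indicator {real m} (real (Suc j)))"
    using assms by (intro suminf_finite) (auto simp: indicator_def)
  also have "\<dots> = ennreal (w m)" using assms by simp
  finally show ?thesis using assms by (simp add: measure_def)
qed

lemma measurable_min_sq_dist [measurable]:
  assumes "finite \<alpha>" "\<alpha> \<noteq> {}"
  shows "min_sq_dist \<alpha> \<in> borel_measurable borel"
proof -
  have "(\<lambda>x. Min ((\<lambda>a. \<bar>x - a\<bar>\<^sup>2) ` \<alpha>)) \<in> borel_measurable borel"
    using assms by (intro borel_measurable_Min) auto
  then show ?thesis by (simp add: min_sq_dist_def[abs_def])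
qed

text \<open>An abbreviation, so that the lemmas apply verbatim to the weight function written out in
  the final theorem.\<close>

abbreviation swapped_weight :: "nat \<Rightarrow> real" where
  "swapped_weight \<equiv> \<lambda>j. if j = 1 then 1 / 2\<^sup>2 else if j = 2 then 1 / 2 else 1 / 2 ^ j"

lemma distortion_swapped:
  assumes "finite \<alpha>" "\<alpha> \<noteq> {}"
  shows "distortion (dirac_series swapped_weight) \<alpha> = ennreal (swapped_error \<alpha>)"
proof -
  let ?f = "\<lambda>j. swapped_weight (Suc j) * min_sq_dist \<alpha> (real (Suc j))"
  have nn: "0 \<le> ?f j" for j using min_sq_dist_nonneg[OF assms] by simp
  \<comment> \<open>Indices 0 and 1 are the atoms 1 and 2; index \<open>j + 2\<close> is the atom
    \<open>3 + j\<close> of weight \<open>1 / 2 ^ (j + 3)\<close>.\<close>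
  have tail: "?f (j + 2) = min_sq_dist \<alpha> (3 + real j) / 2 ^ j / 8" for j
    by (simp add: add_ac)
  have "(\<lambda>j. min_sq_dist \<alpha> (3 + real j) / 2 ^ j / 8) sums (geo_error 3 \<alpha> / 8)"
    unfolding geo_error_def by (intro sums_divide summable_sums summable_geo_error assms)
  then have "(\<lambda>j. ?f (j + 2)) sums (geo_error 3 \<alpha> / 8)" unfolding tail .
  then have "?f sums (geo_error 3 \<alpha> / 8 + (\<Sum>j<2. ?f j))" by (rule sums_iff_shift[THEN iffD1])
  then have f: "?f sums swapped_error \<alpha>"
    by (simp add: swapped_error_def numeral_2_eq_2 add_ac)
  have "distortion (dirac_series swapped_weight) \<alpha>
      = (\<integral>\<^sup>+ x. ennreal (min_sq_dist \<alpha> x) \<partial>dirac_series swapped_weight)"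
    by (simp add: distortion_def min_sq_dist_def)
  also have "\<dots> = (\<Sum>j. ennreal (swapped_weight (Suc j)) * ennreal (min_sq_dist \<alpha> (real (Suc j))))"
    using measurable_min_sq_dist[OF assms] by (intro nn_integral_dirac_series) simp
  also have "\<dots> = (\<Sum>j. ennreal (?f j))"
    using min_sq_dist_nonneg[OF assms] by (intro suminf_cong ennreal_mult[symmetric]) simp_all
  also have "\<dots> = ennreal (swapped_error \<alpha>)"
    using f nn by (simp add: suminf_ennreal2 sums_iff)
  finally show ?thesis .
qed

section \<open>The averages in the optimal sets\<close>

text \<open>From atom 3 on, consecutive weights are in ratio 2 to 1, so the mean lies one third of
  the way.\<close>

lemma Av_swapped:
  assumes "3 \<le> i"
  shows "Av (dirac_series swapped_weight) i (Suc i) = real i + 1/3"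
proof -
  have "measure (dirac_series swapped_weight) {real m} = 1 / 2 ^ m" if "3 \<le> m" for m
    using measure_dirac_series[of m swapped_weight] that by simp
  note w = this
  have "{i..Suc i} = {i, Suc i}" by auto
  then have "Av (dirac_series swapped_weight) i (Suc i)
      = (1 / 2 ^ i * real i + 1 / 2 ^ Suc i * real (Suc i)) / (1 / 2 ^ i + 1 / 2 ^ Suc i)"
    using w[of i] w[of "Suc i"] assms unfolding Av_def by (simp del: of_nat_Suc power_Suc)
  also have "\<dots> = real i + 1/3" by (simp add: field_simps)
  finally show ?thesis .
qed

text \<open>Up to the common factor \<open>1 / 2 ^ i\<close>, the tail has first moment
  \<open>2 * i + 2\<close> and mass 2.\<close>

lemma Av_inf_swapped:
  assumes "3 \<le> i"
  shows "Av_inf (dirac_series swapped_weight) i = real i + 1"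
proof -
  have *: "measure (dirac_series swapped_weight) {real (i + m)} = 1 / 2 ^ i * (1 / 2 ^ m)" for m
    using measure_dirac_series[of "i + m" swapped_weight] assms by (simp add: power_add)
  have "(\<lambda>m. 1 / 2 ^ i * (1 / 2 ^ m) :: real) sums (1 / 2 ^ i * 2)"
    by (intro sums_mult geo_moments)
  moreover have "(\<lambda>m. 1 / 2 ^ i * (real i * (1 / 2 ^ m) + real m / 2 ^ m))
      sums (1 / 2 ^ i * (real i * 2 + 2))"
    by (intro sums_mult sums_add geo_moments)
  then have "(\<lambda>m. 1 / 2 ^ i * (1 / 2 ^ m) * real (i + m)) sums (1 / 2 ^ i * (real i * 2 + 2))"
    by (simp add: field_simps)
  ultimately have "Av_inf (dirac_series swapped_weight) i = (1 / 2 ^ i * (real i * 2 + 2)) / (1 / 2 ^ i * 2)"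
    unfolding Av_inf_def * by (simp only: sums_iff)
  also have "\<dots> = real i + 1" by (simp add: field_simps)
  finally show ?thesis .
qed

lemma real_image_shift3: "real ` {1..m + 2} = insert 1 (insert 2 ((\<lambda>j. 3 + real j) ` {..<m}))"
proof -
  have "{1..m + 2} = insert 1 (insert 2 ((\<lambda>j. 3 + j) ` {..<m}))"
    by (auto simp: image_iff Bex_def) presburger
  then show ?thesis by (simp add: image_image)
qed

section \<open>Optimal sets and quantization error\<close>

theorem proposition4p1p4:
  fixes P :: "real measure" and n :: nat
  assumes "conjecture_C"
    and "P = dirac_series (\<lambda>j. if j = 1 then 1 / 2\<^sup>2 else if j = 2 then 1 / 2 else 1 / 2 ^ j)"
    and "n \<ge> 5"
  shows "{\<alpha>. optimal_n_means P n \<alpha>} =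
      {real ` {1..n - 3} \<union> {Av P (n - 2) (n - 1), Av P n (n + 1), Av_inf P (n + 2)},
       real ` {1..n - 2} \<union> {Av P (n - 1) n, Av_inf P (n + 1)}}
    \<and> quantization_error P n = ennreal (2 powi (3 - int n) / 3)"
proof -
  obtain m where n: "n = m + 5" using assms(3) by (metis add.commute le_Suc_ex)
  define A where "A = real ` {1..n - 3} \<union> {Av P (n - 2) (n - 1), Av P n (n + 1), Av_inf P (n + 2)}"
  define B where "B = real ` {1..n - 2} \<union> {Av P (n - 1) n, Av_inf P (n + 1)}"
  define v :: real where "v = 1 / (12 * 2 ^ m)"
  \<comment> \<open>The averages start at \<open>n - 2 = m + 3\<close>, \<open>n = m + 5\<close> and
    \<open>n + 2 = m + 7\<close>; their values \<open>m + 3 + 1/3\<close>,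
    \<open>m + 5 + 1/3\<close> and \<open>m + 8\<close> are the last three points of
    \<open>three_pattern 3 m\<close>.\<close>
  have A: "A = insert 1 (insert 2 (three_pattern 3 m))"
    using Av_swapped[of "m + 3"] Av_swapped[of "m + 5"] Av_inf_swapped[of "m + 7"]
      real_image_shift3[of m]
    unfolding A_def assms(2) n three_pattern_def by (simp add: algebra_simps eval_nat_numeral insert_commute)
  \<comment> \<open>The averages start at \<open>m + 4\<close> and \<open>m + 6\<close>, with values
    \<open>m + 4 + 1/3\<close> and \<open>m + 7\<close>; the point \<open>n - 2\<close> is the extra
    isolated atom in \<open>two_pattern 3 (Suc m)\<close>.\<close>
  have B: "B = insert 1 (insert 2 (two_pattern 3 (Suc m)))"
    using Av_swapped[of "m + 4"] Av_inf_swapped[of "m + 6"] real_image_shift3[of "Suc m"]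
    unfolding B_def assms(2) n two_pattern_def by (simp add: algebra_simps eval_nat_numeral insert_commute)
  have card_A: "card A \<le> n"
  proof -
    have "card A \<le> card (real ` {1..n - 3}) + card {Av P (n - 2) (n - 1), Av P n (n + 1), Av_inf P (n + 2)}"
      unfolding A_def by (rule card_Un_le)
    also have "\<dots> \<le> (n - 3) + 3"
      by (intro add_mono order_trans[OF card_image_le] order_trans[OF card_insert_le_m1]) auto
    finally show ?thesis using n by simp
  qed
  have card_B: "card B \<le> n"
  proof -
    have "card B \<le> card (real ` {1..n - 2}) + card {Av P (n - 1) n, Av_inf P (n + 1)}"
      unfolding B_def by (rule card_Un_le)
    also have "\<dots> \<le> (n - 2) + 2"
      by (intro add_mono order_trans[OF card_image_le] order_trans[OF card_insert_le_m1]) auto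
    finally show ?thesis using n by simp
  qed
  have fin: "finite A" "finite B" "A \<noteq> {}" "B \<noteq> {}" unfolding A B by simp_all
  define F where "F = {\<alpha> :: real set. finite \<alpha> \<and> 1 \<le> card \<alpha> \<and> card \<alpha> \<le> n}"
  have AB: "A \<in> F" "B \<in> F"
    using fin card_A card_B by (auto simp: F_def Suc_le_eq card_gt_0_iff)
  have dist: "distortion P \<alpha> = ennreal (swapped_error \<alpha>)" if "\<alpha> \<in> F" for \<alpha>
    using that distortion_swapped[of \<alpha>] unfolding assms(2) F_def by fastforce
  have low: "v \<le> swapped_error \<alpha>" "swapped_error \<alpha> \<le> v \<Longrightarrow> \<alpha> \<in> {A, B}" if "\<alpha> \<in> F" for \<alpha>
  proof -
    have "finite \<alpha>" "\<alpha> \<noteq> {}" "card \<alpha> \<le> m + 5" using that n by (auto simp: F_def)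
    from swapped_error_lower_bound[OF this]
    show "v \<le> swapped_error \<alpha>" "swapped_error \<alpha> \<le> v \<Longrightarrow> \<alpha> \<in> {A, B}"
      unfolding A B v_def by blast+
  qed
  have err: "swapped_error \<alpha> = v" if "\<alpha> \<in> {A, B}" for \<alpha>
  proof -
    have "swapped_error A \<le> v" "swapped_error B \<le> v"
      using swapped_error_insert_le[of "three_pattern 3 m"] three_pattern_error[of 3 m]
        swapped_error_insert_le[of "two_pattern 3 (Suc m)"] two_pattern_error[of 3 "Suc m"]
      unfolding A B v_def by simp_all
    then show ?thesis using low(1) AB that by force
  qed
  \<comment> \<open>\<open>ennreal\<close> is injective only on nonnegative reals; positivity of
    \<open>v\<close> allows equal distortions to be compared as reals.\<close>
  have "0 < v" by (simp add: v_def)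
  have q: "quantization_error P n = ennreal v"
    unfolding quantization_error_def F_def[symmetric]
  proof (rule antisym)
    show "(INF \<alpha>\<in>F. distortion P \<alpha>) \<le> ennreal v"
      using AB(1) err[of A] dist[of A] by (intro INF_lower2[of A]) auto
    show "ennreal v \<le> (INF \<alpha>\<in>F. distortion P \<alpha>)"
      using low(1) by (intro INF_greatest) (simp add: dist ennreal_leI)
  qed
  have opt: "optimal_n_means P n \<alpha> \<longleftrightarrow> \<alpha> \<in> F \<and> distortion P \<alpha> = ennreal v" for \<alpha>
    unfolding optimal_n_means_def q F_def by auto
  have "{\<alpha>. optimal_n_means P n \<alpha>} = {A, B}"
  proof (intro set_eqI iffI)
    fix \<alpha> assume "\<alpha> \<in> {\<alpha>. optimal_n_means P n \<alpha>}"
    then have \<alpha>: "\<alpha> \<in> F" "ennreal (swapped_error \<alpha>) = ennreal v" using opt dist by auto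
    then have "swapped_error \<alpha> = v" using low(1)[OF \<alpha>(1)] \<open>0 < v\<close> by (simp add: ennreal_inj)
    then show "\<alpha> \<in> {A, B}" using low(2)[OF \<alpha>(1)] by simp
  next
    fix \<alpha> assume "\<alpha> \<in> {A, B}"
    then show "\<alpha> \<in> {\<alpha>. optimal_n_means P n \<alpha>}" using AB opt dist err by auto
  qed
  \<comment> \<open>\<open>12 * 2 ^ m = 3 * 2 ^ (m + 2)\<close> and
    \<open>3 - n = -(m + 2)\<close>.\<close>
  moreover have "v = 2 powi (3 - int n) / 3"
    by (simp add: v_def n power_int_minus power_int_add power_int_diff field_simps)
  ultimately show ?thesis using q unfolding A_def B_def by (simp only: simp_thms)
qed

end
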